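(* Suppose that $0<\tau<\frac{1+\sqrt5}{2}$ and $\beta>\bar\beta$, where $$\bar\beta=\max\left\{\max\{1/\tau,\tau\}\cdot\lambda_{\max},\ -\frac{\lambda_{\min}}{2}+\frac12\sqrt{\lambda_{\min}^2+\max\left\{\frac1\tau,\frac{\tau^2}{1+\tau-\tau^2}\right\}\cdot8\lambda_{\max}^2}\right\}.$$ Let $\{(L^k,S^k,Z^k,\Lambda^k)\}$ be a sequence generated by the ADMM described in the context. Suppose that (a1) $\mathcal{B}^*\mathcal{B}\succeq\sigma\mathcal{I}$ for some $\sigma>0$ and $\mathcal{C}^*\mathcal{C}\succeq\sigma'\mathcal{I}$ for some $\sigma'>0$; (a2) $\Psi$ is continuous in its domain; (a3) the first iterate satisfies $\Theta_{\tau,\beta}(L^1,S^1,Z^1,\Lambda^1)<h_0:=\liminf_{\|L\|_F+\|S\|_F\to\infty}\Psi(L)+\Phi(S)$. Then: (i) $\lim_{k\to\infty}\left(\|L^{k+1}-L^k\|_F+\|S^{k+1}-S^k\|_F+\|Z^{k+1}-Z^k\|_F+\|\Lambda^{k+1}-\Lambda^k\|_F\right)=0$; (ii) for any cluster point $(L^*,S^*,Z^*,\Lambda^* )$ of the sequence $\{(L^k,S^k,Z^k,\Lambda^k)\}$, the pair $(L^*,S^* )$ is a stationary point of the problem $\min_{L,S}\Psi(L)+\Phi(S)+\frac12\|D-\mathcal{A}[\mathcal{B}(L)+\mathcal{C}(S)]\|_F^2$.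
   Context: Setting. $\mathbb{R}^{m\times n}$ carries the trace inner product $\langle X,Y\rangle=\sum_{i,j}x_{ij}y_{ij}$ and Frobenius norm $\|\cdot\|_F$. $D\in\mathbb{R}^{m\times n}$ is given. $\Psi,\Phi:\mathbb{R}^{m\times n}\to\mathbb{R}_+\cup\{\infty\}$ are proper closed (lower semicontinuous) nonnegative functions, $\Psi$ is convex, $\Phi$ is possibly nonconvex and nonsmooth. "Continuous in its domain" means that the restriction of $\Psi$ to $\operatorname{dom}\Psi=\{L:\Psi(L)<\infty\}$ is continuous. $\mathcal{A},\mathcal{B},\mathcal{C}:\mathbb{R}^{m\times n}\to\mathbb{R}^{m\times n}$ are linear maps with $\mathcal{B},\mathcal{C}$ injective; $^*$ denotes the adjoint, $\mathcal{I}$ the identity map. $\lambda_{\max}$ and $\lambda_{\min}$ are the largest and smallest eigenvalues of $\mathcal{A}^*\mathcal{A}$. The problem is $\min_{L,S}\Psi(L)+\Phi(S)+\frac12\|D-\mathcal{A}[\mathcal{B}(L)+\mathcal{C}(S)]\|_F^2$. Its augmented Lagrangian (after introducing $Z=\mathcal{B}(L)+\mathcal{C}(S)$), with penalty parameter $\beta>0$, is $$\mathcal{L}_\beta(L,S,Z,\Lambda)=\Psi(L)+\Phi(S)+\tfrac12\|D-\mathcal{A}(Z)\|_F^2-\langle\Lambda,\mathcal{B}(L)+\mathcal{C}(S)-Z\rangle+\tfrac\beta2\|\mathcal{B}(L)+\mathcal{C}(S)-Z\|_F^2 .$$ ADMM. Given an initial point $(S^0,Z^0,\Lambda^0)$,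 dual step-size $\tau>0$ and $\beta>0$, for $k=0,1,2,\dots$ a sequence generated by the ADMM satisfies $L^{k+1}\in\operatorname{Argmin}_L\mathcal{L}_\beta(L,S^k,Z^k,\Lambda^k)$; $S^{k+1}\in\operatorname{Argmin}_S\mathcal{L}_\beta(L^{k+1},S,Z^k,\Lambda^k)$; $Z^{k+1}=\operatorname{argmin}_Z\mathcal{L}_\beta(L^{k+1},S^{k+1},Z,\Lambda^k)$; $\Lambda^{k+1}=\Lambda^k-\tau\beta(\mathcal{B}(L^{k+1})+\mathcal{C}(S^{k+1})-Z^{k+1})$. Potential function. For $0<\tau<\frac{1+\sqrt5}{2}$, let $\theta(\tau)=\max\left\{1-\tau,\frac{(\tau-1)\tau^2}{1+\tau-\tau^2}\right\}$ and $$\Theta_{\tau,\beta}(L,S,Z,\Lambda)=\mathcal{L}_\beta(L,S,Z,\Lambda)+\theta(\tau)\beta\|\mathcal{B}(L)+\mathcal{C}(S)-Z\|_F^2 .$$ Subdifferential. For a proper function $f$ and $X\in\operatorname{dom}f$, the Fréchet subdifferential $\widehat\partial f(X)$ is the set of $G$ with $\liminf_{Y\ne X,\,Y\to X}\frac{f(Y)-f(X)-\langle G,Y-X\rangle}{\|Y-X\|_F}\ge0$, and the (limiting) subdifferential $\partial f(X)$ is the set of $G$ for which there exist $X^k\to X$ with $f(X^k)\to f(X)$ and $G^k\to G$ with $G^k\in\widehat\partial f(X^k)$ for all $k$. (For convex $f$ it is the usual convex subdifferential.) Stationary point. $(L^*,S^* )$ is a stationary point of the problem if $0\in\partial\Psi(L^*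 )+\mathcal{B}^*\mathcal{A}^*(\mathcal{A}(\mathcal{B}(L^* )+\mathcal{C}(S^* ))-D)$ and $0\in\partial\Phi(S^* )+\mathcal{C}^*\mathcal{A}^*(\mathcal{A}(\mathcal{B}(L^* )+\mathcal{C}(S^* ))-D)$. *)

theory Defs
  imports "HOL-Analysis.Analysis"
begin

(* The space of real m x n matrices is the type real ^ 'n ^ 'm.  Its library inner product is
   the sum of the products of corresponding entries, so norm is the Frobenius norm and
   adjoint is taken with respect to the trace inner product. *)

definition eff_dom :: "('a \<Rightarrow> ereal) \<Rightarrow> 'a set" where
  "eff_dom f = {x. f x < \<infinity>}"

definition proper_fun :: "('a \<Rightarrow> ereal) \<Rightarrow> bool" where
  "proper_fun f \<longleftrightarrow> eff_dom f \<noteq> {} \<and> (\<forall>x. f x \<noteq> -\<infinity>)"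

definition lsc_fun :: "('a::topological_space \<Rightarrow> ereal) \<Rightarrow> bool" where
  "lsc_fun f \<longleftrightarrow> (\<forall>x. f x \<le> Liminf (at x) f)"

(* The library's convex_on does not apply: ereal is not a real vector space.  The weights
   are taken in the open interval so that no product of 0 with infinity occurs. *)
definition convex_fun :: "('a::real_vector \<Rightarrow> ereal) \<Rightarrow> bool" where
  "convex_fun f \<longleftrightarrow>
     (\<forall>x y. \<forall>t\<in>{0<..<1}.
        f ((1 - t) *\<^sub>R x + t *\<^sub>R y) \<le> ereal (1 - t) * f x + ereal t * f y)"

(* Both subdifferentials are empty outside the effective domain.  The functions they are
   applied to are proper, so f x below is finite and the subtraction is not degenerate. *)
definition frechet_subdiff :: "('a::real_inner \<Rightarrow> ereal) \<Rightarrow> 'a \<Rightarrow> 'a set" where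
  "frechet_subdiff f x =
     {g. x \<in> eff_dom f \<and>
         0 \<le> Liminf (at x) (\<lambda>y. (f y - f x - ereal (g \<bullet> (y - x))) / ereal (norm (y - x)))}"

definition limiting_subdiff :: "('a::real_inner \<Rightarrow> ereal) \<Rightarrow> 'a \<Rightarrow> 'a set" where
  "limiting_subdiff f x =
     {g. x \<in> eff_dom f \<and>
         (\<exists>xs gs. xs \<longlonglongrightarrow> x \<and> (\<lambda>k. f (xs k)) \<longlonglongrightarrow> f x \<and> gs \<longlonglongrightarrow> g \<and>
            (\<forall>k. gs k \<in> frechet_subdiff f (xs k)))}"

definition op_eigenvalues :: "('a::real_vector \<Rightarrow> 'a) \<Rightarrow> real set" where
  "op_eigenvalues T = {\<mu>. \<exists>x. x \<noteq> 0 \<and> T x = \<mu> *\<^sub>R x}"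

(* Max and Min are meaningful only on finite nonempty sets; these are used for self-adjoint
   operators on a nontrivial Euclidean space, whose set of eigenvalues is such a set. *)
definition lambda_max :: "('a::real_vector \<Rightarrow> 'a) \<Rightarrow> real" where
  "lambda_max T = Max (op_eigenvalues T)"

definition lambda_min :: "('a::real_vector \<Rightarrow> 'a) \<Rightarrow> real" where
  "lambda_min T = Min (op_eigenvalues T)"

definition psd_op :: "('a::real_inner \<Rightarrow> 'a) \<Rightarrow> bool" where
  "psd_op T \<longleftrightarrow> linear T \<and> (\<forall>x y. T x \<bullet> y = x \<bullet> T y) \<and> (\<forall>x. 0 \<le> T x \<bullet> x)"

definition loewner_ge :: "('a::real_inner \<Rightarrow> 'a) \<Rightarrow> ('a \<Rightarrow> 'a) \<Rightarrow> bool" where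
  "loewner_ge T U \<longleftrightarrow> psd_op (\<lambda>x. T x - U x)"

definition stationary_point ::
  "('a::euclidean_space \<Rightarrow> ereal) \<Rightarrow> ('a \<Rightarrow> ereal) \<Rightarrow> ('a \<Rightarrow> 'a) \<Rightarrow> ('a \<Rightarrow> 'a) \<Rightarrow> ('a \<Rightarrow> 'a) \<Rightarrow> 'a \<Rightarrow>
   'a \<Rightarrow> 'a \<Rightarrow> bool" where
  "stationary_point \<Psi> \<Phi> A B C D L S \<longleftrightarrow>
     0 \<in> (\<lambda>G. G + adjoint B (adjoint A (A (B L + C S) - D))) ` limiting_subdiff \<Psi> L \<and>
     0 \<in> (\<lambda>G. G + adjoint C (adjoint A (A (B L + C S) - D))) ` limiting_subdiff \<Phi> S"

definition aug_lagrangian ::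
  "('a::euclidean_space \<Rightarrow> ereal) \<Rightarrow> ('a \<Rightarrow> ereal) \<Rightarrow> ('a \<Rightarrow> 'a) \<Rightarrow> ('a \<Rightarrow> 'a) \<Rightarrow> ('a \<Rightarrow> 'a) \<Rightarrow> 'a \<Rightarrow>
   real \<Rightarrow> 'a \<Rightarrow> 'a \<Rightarrow> 'a \<Rightarrow> 'a \<Rightarrow> ereal" where
  "aug_lagrangian \<Psi> \<Phi> A B C D \<beta> L S Z \<Lambda> =
     \<Psi> L + \<Phi> S +
     ereal (1/2 * (norm (D - A Z))\<^sup>2 - \<Lambda> \<bullet> (B L + C S - Z) + \<beta>/2 * (norm (B L + C S - Z))\<^sup>2)"

(* L 0 is a dummy: the initial data are S 0, Z 0 and \<Lambda> 0, and no clause mentions L 0.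
   The infinite value is allowed as a minimum here, so if \<Phi> (S 0) is infinite then every
   matrix is admissible as L 1. *)
definition admm_sequence ::
  "('a::euclidean_space \<Rightarrow> ereal) \<Rightarrow> ('a \<Rightarrow> ereal) \<Rightarrow> ('a \<Rightarrow> 'a) \<Rightarrow> ('a \<Rightarrow> 'a) \<Rightarrow> ('a \<Rightarrow> 'a) \<Rightarrow> 'a \<Rightarrow>
   real \<Rightarrow> real \<Rightarrow> (nat \<Rightarrow> 'a) \<Rightarrow> (nat \<Rightarrow> 'a) \<Rightarrow> (nat \<Rightarrow> 'a) \<Rightarrow> (nat \<Rightarrow> 'a) \<Rightarrow> bool" where
  "admm_sequence \<Psi> \<Phi> A B C D \<tau> \<beta> L S Z \<Lambda> \<longleftrightarrow>
     (\<forall>k.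
        is_arg_min (\<lambda>X. aug_lagrangian \<Psi> \<Phi> A B C D \<beta> X (S k) (Z k) (\<Lambda> k)) (\<lambda>_. True) (L (Suc k)) \<and>
        is_arg_min (\<lambda>X. aug_lagrangian \<Psi> \<Phi> A B C D \<beta> (L (Suc k)) X (Z k) (\<Lambda> k)) (\<lambda>_. True) (S (Suc k)) \<and>
        is_arg_min (\<lambda>X. aug_lagrangian \<Psi> \<Phi> A B C D \<beta> (L (Suc k)) (S (Suc k)) X (\<Lambda> k)) (\<lambda>_. True) (Z (Suc k)) \<and>
        \<Lambda> (Suc k) = \<Lambda> k - (\<tau> * \<beta>) *\<^sub>R (B (L (Suc k)) + C (S (Suc k)) - Z (Suc k)))"

definition theta :: "real \<Rightarrow> real" where
  "theta \<tau> = max (1 - \<tau>) ((\<tau> - 1) * \<tau>\<^sup>2 / (1 + \<tau> - \<tau>\<^sup>2))"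

definition potential ::
  "('a::euclidean_space \<Rightarrow> ereal) \<Rightarrow> ('a \<Rightarrow> ereal) \<Rightarrow> ('a \<Rightarrow> 'a) \<Rightarrow> ('a \<Rightarrow> 'a) \<Rightarrow> ('a \<Rightarrow> 'a) \<Rightarrow> 'a \<Rightarrow>
   real \<Rightarrow> real \<Rightarrow> 'a \<Rightarrow> 'a \<Rightarrow> 'a \<Rightarrow> 'a \<Rightarrow> ereal" where
  "potential \<Psi> \<Phi> A B C D \<tau> \<beta> L S Z \<Lambda> =
     aug_lagrangian \<Psi> \<Phi> A B C D \<beta> L S Z \<Lambda> + ereal (theta \<tau> * \<beta> * (norm (B L + C S - Z))\<^sup>2)"

definition beta_bar :: "('a::euclidean_space \<Rightarrow> 'a) \<Rightarrow> real \<Rightarrow> real" where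
  "beta_bar A \<tau> =
     (let lmax = lambda_max (adjoint A \<circ> A); lmin = lambda_min (adjoint A \<circ> A)
      in max (max (1 / \<tau>) \<tau> * lmax)
             (- lmin / 2 +
              1/2 * sqrt (lmin\<^sup>2 + max (1 / \<tau>) (\<tau>\<^sup>2 / (1 + \<tau> - \<tau>\<^sup>2)) * (8 * lmax\<^sup>2))))"

(* The filter describes norm L + norm S tending to infinity. *)
definition liminf_at_infinity ::
  "('a::euclidean_space \<Rightarrow> ereal) \<Rightarrow> ('a \<Rightarrow> ereal) \<Rightarrow> ereal" where
  "liminf_at_infinity \<Psi> \<Phi> =
     Liminf (filtercomap (\<lambda>(L, S). norm L + norm S) at_top) (\<lambda>(L, S). \<Psi> L + \<Phi> S)"

definition cluster_point :: "(nat \<Rightarrow> 'a::metric_space) \<Rightarrow> 'a \<Rightarrow> bool" where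
  "cluster_point X x \<longleftrightarrow> (\<exists>r. strict_mono r \<and> (X \<circ> r) \<longlonglongrightarrow> x)"

end

theory Submission
  imports Defs
begin

text \<open>Write \<open>r\<^sub>k = B L\<^sub>k + C S\<^sub>k - Z\<^sub>k\<close> and \<open>g\<^sub>k = A\<^sup>* (A Z\<^sub>k - D)\<close>. Optimality of the
  \<open>Z\<close>-step reads \<open>\<beta> r\<^bsub>k+1\<^esub> = \<Lambda>\<^sub>k + g\<^bsub>k+1\<^esub>\<close>, so the multiplier can be eliminated:
  \<open>r\<^bsub>k+1\<^esub> = (1 - \<tau>) r\<^sub>k + (g\<^bsub>k+1\<^esub> - g\<^sub>k) / \<beta>\<close>. The increase of the augmented Lagrangian in the
  dual step is \<open>\<tau> \<beta> |r\<^bsub>k+1\<^esub>|\<^sup>2\<close>; by the recurrence it is paid for by the term \<open>\<theta> \<beta> |r|\<^sup>2\<close> of the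
  potential and by the decrease in the \<open>Z\<close>-step. A small extra multiple of \<open>|r|\<^sup>2\<close> can be added, and
  the decrease of the resulting function dominates \<open>|B (L\<^bsub>k+1\<^esub> - L\<^sub>k)|\<^sup>2\<close>, \<open>|Z\<^bsub>k+1\<^esub> - Z\<^sub>k|\<^sup>2\<close> and
  \<open>|r\<^sub>k|\<^sup>2\<close> at once. Inserting \<open>\<Lambda>\<^sub>k = (1 - \<tau>) \<beta> r\<^sub>k - g\<^sub>k\<close> completes a square and shows that the
  potential is nonnegative, hence these quantities tend to \<open>0\<close>. At a cluster point one passes to
  the limit in the optimality conditions of the \<open>L\<close>- and \<open>S\<close>-steps.\<close>

subsection \<open>Extreme eigenvalues\<close>

text \<open>For small \<open>t\<close> of sign opposite to \<open>a\<close> the linear term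
  dominates. This replaces differentiation in the first-order conditions below.\<close>

lemma linear_coeff_eq_0_if_quadratic_nonneg:
  fixes a c :: real
  assumes "\<And>t. 0 \<le> t * a + t\<^sup>2 * c"
  shows "a = 0"
proof (rule ccontr)
  assume "a \<noteq> 0"
  \<comment> \<open>\<open>d\<close> is positive and bounds \<open>c\<close> whatever its sign;
    \<open>t = - a / (2 * d)\<close> minimizes \<open>t * a + t^2 * d\<close>.\<close>
  define d where "d = \<bar>c\<bar> + 1"
  have d: "d > 0" "c \<le> d" by (auto simp: d_def)
  have "0 \<le> (- a / (2 * d)) * a + (- a / (2 * d))\<^sup>2 * c"
    by (rule assms)
  also have "\<dots> \<le> (- a / (2 * d)) * a + (- a / (2 * d))\<^sup>2 * d"
    using d by (intro add_left_mono mult_left_mono) auto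
  also have "\<dots> = - (a\<^sup>2 / (4 * d))"
    using d by (simp add: field_simps power2_eq_square)
  also have "\<dots> < 0" using d \<open>a \<noteq> 0\<close> by simp
  finally show False by simp
qed

text \<open>The quadratic form of \<open>T\<close> attains its minimum 0 at \<open>x\<close>, so its
  derivative at \<open>x\<close> in the direction \<open>T x\<close>, which is 2 |T x|^2,
  vanishes.\<close>

lemma psd_op_kernel:
  assumes "psd_op T" "T x \<bullet> x = 0"
  shows "T x = 0"
proof -
  interpret linear T using assms by (simp add: psd_op_def)
  have sym: "T u \<bullet> v = u \<bullet> T v" for u v using assms by (simp add: psd_op_def)
  have "2 * (T x \<bullet> T x) = 0"
  proof (rule linear_coeff_eq_0_if_quadratic_nonneg)
    fix t :: real
    have "0 \<le> T (x + t *\<^sub>R T x) \<bullet> (x + t *\<^sub>R T x)"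
      using assms(1) unfolding psd_op_def by blast
    also have "\<dots> = t * (2 * (T x \<bullet> T x)) + t\<^sup>2 * (T (T x) \<bullet> T x)"
      using assms(2) sym[of "T x" x]
      by (simp add: add scale inner_add algebra_simps power2_eq_square inner_commute)
    finally show "0 \<le> t * (2 * (T x \<bullet> T x)) + t\<^sup>2 * (T (T x) \<bullet> T x)" .
  qed
  then show ?thesis by simp
qed

text \<open>Eigenvectors for distinct eigenvalues are orthogonal, hence independent. Finiteness
  gives \<open>Max\<close> and \<open>Min\<close> of the spectrum their meaning.\<close>

lemma finite_op_eigenvalues:
  fixes T :: "'a::euclidean_space \<Rightarrow> 'a"
  assumes sym: "\<And>x y. T x \<bullet> y = x \<bullet> T y"
  shows "finite (op_eigenvalues T)"
proof -
  define v where "v \<mu> = (SOME x. x \<noteq> 0 \<and> T x = \<mu> *\<^sub>R x)" for \<mu>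
  have v: "v \<mu> \<noteq> 0" "T (v \<mu>) = \<mu> *\<^sub>R v \<mu>" if "\<mu> \<in> op_eigenvalues T" for \<mu>
    using that someI_ex[of "\<lambda>x. x \<noteq> 0 \<and> T x = \<mu> *\<^sub>R x"]
    by (auto simp: op_eigenvalues_def v_def)
  have inj: "inj_on v (op_eigenvalues T)"
  proof (rule inj_onI)
    fix \<mu> \<nu> assume *: "\<mu> \<in> op_eigenvalues T" "\<nu> \<in> op_eigenvalues T" "v \<mu> = v \<nu>"
    then have "\<mu> *\<^sub>R v \<mu> = \<nu> *\<^sub>R v \<mu>" using v(2) by metis
    then show "\<mu> = \<nu>" using v(1) * by auto
  qed
  have "pairwise orthogonal (v ` op_eigenvalues T)"
  proof (clarsimp simp: pairwise_def orthogonal_def)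
    fix \<mu> \<nu> assume *: "\<mu> \<in> op_eigenvalues T" "\<nu> \<in> op_eigenvalues T" "v \<mu> \<noteq> v \<nu>"
    have "(\<mu> - \<nu>) * (v \<mu> \<bullet> v \<nu>) = 0"
      using sym[of "v \<mu>" "v \<nu>"] v(2) * by (simp add: algebra_simps)
    then show "v \<mu> \<bullet> v \<nu> = 0" using * by auto
  qed
  moreover have "0 \<notin> v ` op_eigenvalues T" using v(1) by (metis imageE)
  ultimately have "finite (v ` op_eigenvalues T)"
    by (metis finiteI_independent pairwise_orthogonal_independent)
  then show ?thesis using inj by (rule finite_imageD)
qed

text \<open>The form attains a maximum \<open>M\<close> on the compact unit sphere. Then
  \<open>M\<close> times the identity minus \<open>T\<close> is positive semidefinite and its form
  vanishes at the maximizer, which is therefore an eigenvector by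
  \<open>psd_op_kernel\<close>.\<close>

lemma rayleigh_maximum_eigenvalue:
  fixes T :: "'a::euclidean_space \<Rightarrow> 'a"
  assumes lin: "linear T" and sym: "\<And>x y. T x \<bullet> y = x \<bullet> T y"
  shows "\<exists>M\<in>op_eigenvalues T. \<forall>x. T x \<bullet> x \<le> M * (norm x)\<^sup>2"
proof -
  have "\<exists>x\<in>sphere 0 1. \<forall>y\<in>sphere 0 1. T y \<bullet> y \<le> T x \<bullet> x"
    by (intro continuous_attains_sup continuous_intros linear_continuous_on)
      (use lin in \<open>auto simp: linear_conv_bounded_linear\<close>)
  then obtain x where x: "norm x = 1" "\<And>y. norm y = 1 \<Longrightarrow> T y \<bullet> y \<le> T x \<bullet> x"
    by auto
  define M where "M = T x \<bullet> x"
  have le: "T y \<bullet> y \<le> M * (norm y)\<^sup>2" for y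
  proof (cases "y = 0")
    case True then show ?thesis by simp
  next
    case False
    have "T (y /\<^sub>R norm y) \<bullet> (y /\<^sub>R norm y) \<le> M"
      using x(2)[of "y /\<^sub>R norm y"] False unfolding M_def by simp
    then have "(T y \<bullet> y) / (norm y)\<^sup>2 \<le> M"
      using lin by (simp add: linear_scale divide_simps power2_eq_square)
    then show ?thesis using False by (simp add: divide_simps mult.commute)
  qed
  have "psd_op (\<lambda>y. M *\<^sub>R y - T y)"
    unfolding psd_op_def using lin sym le
    by (auto intro!: linear_compose_sub linear_compose_scale_right linear_ident
        simp: inner_diff power2_norm_eq_inner)
  moreover have "(M *\<^sub>R x - T x) \<bullet> x = 0"
    using x(1) by (simp add: inner_diff M_def flip: power2_norm_eq_inner)
  ultimately have "M *\<^sub>R x - T x = 0" by (rule psd_op_kernel)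
  then have "M \<in> op_eigenvalues T"
    using x(1) by (auto simp: op_eigenvalues_def intro!: exI[of _ x])
  with le show ?thesis by blast
qed

lemma rayleigh_le_lambda_max:
  fixes T :: "'a::euclidean_space \<Rightarrow> 'a"
  assumes lin: "linear T" and sym: "\<And>x y. T x \<bullet> y = x \<bullet> T y"
  shows "T x \<bullet> x \<le> lambda_max T * (norm x)\<^sup>2"
proof -
  obtain M where M: "M \<in> op_eigenvalues T" "T x \<bullet> x \<le> M * (norm x)\<^sup>2"
    using rayleigh_maximum_eigenvalue[OF assms] by blast
  then have "M \<le> lambda_max T"
    unfolding lambda_max_def using finite_op_eigenvalues[OF sym] by simp
  then have "M * (norm x)\<^sup>2 \<le> lambda_max T * (norm x)\<^sup>2"
    by (rule mult_right_mono) simp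
  with M show ?thesis by linarith
qed

text \<open>Apply the maximum result to \<open>- T\<close>, whose eigenvalues are the negatives of
  those of \<open>T\<close>.\<close>

lemma lambda_min_le_rayleigh:
  fixes T :: "'a::euclidean_space \<Rightarrow> 'a"
  assumes lin: "linear T" and sym: "\<And>x y. T x \<bullet> y = x \<bullet> T y"
  shows "lambda_min T * (norm x)\<^sup>2 \<le> T x \<bullet> x"
proof -
  have "\<exists>M\<in>op_eigenvalues (\<lambda>x. - T x). \<forall>x. (- T x) \<bullet> x \<le> M * (norm x)\<^sup>2"
    by (rule rayleigh_maximum_eigenvalue) (use assms in \<open>auto intro: linear_compose_neg\<close>)
  then obtain M where M: "M \<in> op_eigenvalues (\<lambda>x. - T x)" "(- T x) \<bullet> x \<le> M * (norm x)\<^sup>2"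
    by blast
  obtain y where "y \<noteq> 0" "- T y = M *\<^sub>R y"
    using M(1) by (auto simp: op_eigenvalues_def)
  then have "y \<noteq> 0" "T y = (- M) *\<^sub>R y"
    by (metis, metis add.inverse_inverse scaleR_minus_left)
  then have "- M \<in> op_eigenvalues T" by (auto simp: op_eigenvalues_def)
  then have "lambda_min T \<le> - M"
    unfolding lambda_min_def using finite_op_eigenvalues[OF sym] by simp
  then have "lambda_min T * (norm x)\<^sup>2 \<le> - M * (norm x)\<^sup>2"
    by (rule mult_right_mono) simp
  with M show ?thesis by simp
qed

context
  fixes A :: "'a::euclidean_space \<Rightarrow> 'a"
  assumes lin: "linear A"
begin

lemma inner_adjoint_comp_self: "(adjoint A \<circ> A) x \<bullet> y = A x \<bullet> A y"
  using adjoint_works[OF lin, of y "A x"] by (simp add: inner_commute)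

lemma linear_adjoint_comp: "linear (adjoint A \<circ> A)"
  using lin adjoint_linear linear_compose by blast

lemma adjoint_comp_sym: "(adjoint A \<circ> A) x \<bullet> y = x \<bullet> (adjoint A \<circ> A) y"
  by (metis inner_adjoint_comp_self inner_commute)

lemma norm_sq_le_lambda_max: "(norm (A x))\<^sup>2 \<le> lambda_max (adjoint A \<circ> A) * (norm x)\<^sup>2"
  using rayleigh_le_lambda_max[OF linear_adjoint_comp adjoint_comp_sym, of x]
  by (simp only: inner_adjoint_comp_self power2_norm_eq_inner)

lemma lambda_min_le_norm_sq: "lambda_min (adjoint A \<circ> A) * (norm x)\<^sup>2 \<le> (norm (A x))\<^sup>2"
  using lambda_min_le_rayleigh[OF linear_adjoint_comp adjoint_comp_sym, of x]
  by (simp only: inner_adjoint_comp_self power2_norm_eq_inner)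

lemma lambda_max_adjoint_comp_nonneg: "0 \<le> lambda_max (adjoint A \<circ> A)"
proof -
  obtain b :: 'a where "b \<in> Basis" using nonempty_Basis by blast
  then have "0 \<le> (norm (A b))\<^sup>2" "norm b = 1" by auto
  then show ?thesis using norm_sq_le_lambda_max[of b]
    by (metis mult.right_neutral order_trans power_one)
qed

text \<open>Cauchy-Schwarz on |A* A x|^2 = <A x, A A* A x>; each of the two factors contributes
  \<open>sqrt l\<close>. This bound is the source of \<open>lmax\<close> squared in the condition on
  \<open>\<beta>\<close>.\<close>

lemma norm_adjoint_comp_le: "norm (adjoint A (A x)) \<le> lambda_max (adjoint A \<circ> A) * norm x"
proof (cases "adjoint A (A x) = 0")
  case True then show ?thesis using lambda_max_adjoint_comp_nonneg by simp
next
  case False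
  define l where "l = lambda_max (adjoint A \<circ> A)"
  have le: "norm (A y) \<le> sqrt l * norm y" for y
    using real_sqrt_le_mono[OF norm_sq_le_lambda_max[of y]] by (simp add: real_sqrt_mult l_def)
  have "(norm (adjoint A (A x)))\<^sup>2 = A x \<bullet> A (adjoint A (A x))"
    using inner_adjoint_comp_self[of x "adjoint A (A x)"] by (simp add: power2_norm_eq_inner)
  also have "\<dots> \<le> norm (A x) * norm (A (adjoint A (A x)))" by (rule norm_cauchy_schwarz)
  also have "\<dots> \<le> (sqrt l * norm x) * (sqrt l * norm (adjoint A (A x)))"
    using lambda_max_adjoint_comp_nonneg by (intro mult_mono le) (auto simp: l_def)
  also have "\<dots> = (l * norm x) * norm (adjoint A (A x))"
    using lambda_max_adjoint_comp_nonneg by (simp add: l_def)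
  finally show ?thesis using False by (simp add: power2_eq_square l_def)
qed

end

subsection \<open>Subgradients at minimizers of quadratic models\<close>

text \<open>\<open>lsc_fun\<close> uses the punctured filter, but \<open>xs\<close> may hit
  \<open>x\<close>; the eventual bound extends to \<open>nhds x\<close> because
  \<open>c < f x\<close> itself.\<close>

lemma lsc_fun_liminf_le:
  assumes lsc: "lsc_fun f" and lim: "xs \<longlonglongrightarrow> x"
  shows "f x \<le> liminf (\<lambda>k. f (xs k))"
proof (rule le_Liminf_iff[THEN iffD2], intro allI impI)
  fix c assume c: "c < f x"
  also have "f x \<le> Liminf (at x) f" using lsc by (simp add: lsc_fun_def)
  finally have "eventually (\<lambda>y. c < f y) (at x)" by (rule less_LiminfD)
  then have "eventually (\<lambda>y. c < f y) (nhds x)"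
    using c by (auto simp: eventually_at_filter elim: eventually_mono)
  then show "eventually (\<lambda>k. c < f (xs k)) sequentially"
    using lim by (auto simp: filterlim_iff)
qed

text \<open>The part of the augmented Lagrangian that depends on one block: \<open>T\<close> is
  \<open>B\<close> or \<open>C\<close>, and \<open>w\<close> collects the other block and
  \<open>- Z\<close>.\<close>

definition quad_model ::
  "('a \<Rightarrow> 'b::euclidean_space) \<Rightarrow> real \<Rightarrow> 'b \<Rightarrow> 'b \<Rightarrow> 'a \<Rightarrow> real" where
  "quad_model T \<beta> \<Lambda> w y = \<beta> / 2 * (norm (T y + w))\<^sup>2 - \<Lambda> \<bullet> (T y + w)"

text \<open>The second-order expansion at \<open>x\<close>, exact for a quadratic; the vector under
  \<open>adjoint T\<close> yields the negative gradient there.\<close>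

lemma quad_model_diff:
  fixes T :: "'a::euclidean_space \<Rightarrow> 'b::euclidean_space"
  assumes lin: "linear T"
  shows "quad_model T \<beta> \<Lambda> w y - quad_model T \<beta> \<Lambda> w x
    = \<beta> / 2 * (norm (T (y - x)))\<^sup>2 - adjoint T (\<Lambda> - \<beta> *\<^sub>R (T x + w)) \<bullet> (y - x)"
proof -
  have y: "T y = T x + T (y - x)" using lin by (simp add: linear_diff)
  have g: "adjoint T (\<Lambda> - \<beta> *\<^sub>R (T x + w)) \<bullet> (y - x) = (\<Lambda> - \<beta> *\<^sub>R (T x + w)) \<bullet> T (y - x)"
    using adjoint_works[OF lin, of "y - x" "\<Lambda> - \<beta> *\<^sub>R (T x + w)"] by (simp add: inner_commute)
  show ?thesis unfolding quad_model_def g y power2_norm_eq_inner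
    by (simp add: algebra_simps inner_commute)
qed

text \<open>By minimality and the exact expansion, the difference quotient is at least a negative
  multiple of \<open>norm (y - x)\<close>, which tends to 0.\<close>

lemma frechet_subdiff_of_quadratic_minimizer:
  fixes f :: "'a::euclidean_space \<Rightarrow> ereal" and T :: "'a \<Rightarrow> 'b::euclidean_space"
  assumes nonneg: "\<And>y. 0 \<le> f y" and lin: "linear T" and "0 \<le> \<beta>" and fin: "f x < \<infinity>"
    and min: "\<And>y. f x + ereal (quad_model T \<beta> \<Lambda> w x) \<le> f y + ereal (quad_model T \<beta> \<Lambda> w y)"
  shows "adjoint T (\<Lambda> - \<beta> *\<^sub>R (T x + w)) \<in> frechet_subdiff f x"
proof -
  define g where "g = adjoint T (\<Lambda> - \<beta> *\<^sub>R (T x + w))"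
  obtain K where K: "0 < K" "\<And>v. norm (T v) \<le> K * norm v"
    using linear_bounded_pos[OF lin] by blast
  obtain a where a: "f x = ereal a" using fin nonneg[of x] by (cases "f x") auto
  have low: "ereal (- (\<beta> / 2 * K\<^sup>2 * norm (y - x)))
      \<le> (f y - f x - ereal (g \<bullet> (y - x))) / ereal (norm (y - x))" if "y \<noteq> x" for y
  proof (cases "f y")
    case (real b)
    have "a + quad_model T \<beta> \<Lambda> w x \<le> b + quad_model T \<beta> \<Lambda> w y"
      using min[of y] by (simp add: a real)
    then have "a - b \<le> \<beta> / 2 * (norm (T (y - x)))\<^sup>2 - g \<bullet> (y - x)"
      using quad_model_diff[OF lin, of \<beta> \<Lambda> w y x] by (simp add: g_def)
    also have "\<dots> \<le> \<beta> / 2 * (K * norm (y - x))\<^sup>2 - g \<bullet> (y - x)"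
      using K \<open>0 \<le> \<beta>\<close> by (intro diff_right_mono mult_left_mono power_mono) auto
    finally have "- (\<beta> / 2 * K\<^sup>2 * norm (y - x)) * norm (y - x) \<le> b - a - g \<bullet> (y - x)"
      by (simp add: power2_eq_square algebra_simps)
    then have "- (\<beta> / 2 * K\<^sup>2 * norm (y - x)) \<le> (b - a - g \<bullet> (y - x)) / norm (y - x)"
      using that by (subst pos_le_divide_eq) auto
    then show ?thesis using that by (simp add: a real)
  next
    case PInf then show ?thesis using that by (simp add: a)
  next
    case MInf then show ?thesis using nonneg[of y] by simp
  qed
  have "((\<lambda>y. - (\<beta> / 2 * K\<^sup>2 * norm (y - x))) \<longlongrightarrow> - (\<beta> / 2 * K\<^sup>2 * norm (x - x))) (at x)"
    by (intro tendsto_intros)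
  then have "((\<lambda>y. ereal (- (\<beta> / 2 * K\<^sup>2 * norm (y - x)))) \<longlongrightarrow> 0) (at x)"
    by (simp add: zero_ereal_def)
  then have "0 = Liminf (at x) (\<lambda>y. ereal (- (\<beta> / 2 * K\<^sup>2 * norm (y - x))))"
    by (intro lim_imp_Liminf[symmetric]) auto
  also have "\<dots> \<le> Liminf (at x)
      (\<lambda>y. (f y - f x - ereal (g \<bullet> (y - x))) / ereal (norm (y - x)))"
    by (intro Liminf_mono) (use low in \<open>auto simp: eventually_at_filter\<close>)
  finally show ?thesis using fin by (simp add: frechet_subdiff_def g_def eff_dom_def)
qed

text \<open>Minimality gives the upper bound for the values \<open>f (xs k)\<close> and lower semicontinuity the
  lower one.\<close>

lemma limiting_subdiff_of_quadratic_minimizers: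
  fixes f :: "'a::euclidean_space \<Rightarrow> ereal" and T :: "'a \<Rightarrow> 'b::euclidean_space"
  assumes lsc: "lsc_fun f" and nonneg: "\<And>y. 0 \<le> f y" and lin: "linear T" and "0 \<le> \<beta>"
    and fin: "\<And>k. f (xs k) < \<infinity>"
    and min: "\<And>k y. f (xs k) + ereal (quad_model T \<beta> (\<Lambda>s k) (ws k) (xs k))
                \<le> f y + ereal (quad_model T \<beta> (\<Lambda>s k) (ws k) y)"
    and xs: "xs \<longlonglongrightarrow> x" and \<Lambda>s: "\<Lambda>s \<longlonglongrightarrow> \<Lambda>" and ws: "ws \<longlonglongrightarrow> w"
  shows "adjoint T (\<Lambda> - \<beta> *\<^sub>R (T x + w)) \<in> limiting_subdiff f x"
proof -
  define q where "q k y = quad_model T \<beta> (\<Lambda>s k) (ws k) y" for k y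
  have Tlim: "(\<lambda>k. T (us k)) \<longlonglongrightarrow> T u" if "us \<longlonglongrightarrow> u" for us u
    using that lin linear_conv_bounded_linear bounded_linear.tendsto by blast
  have qlim: "(\<lambda>k. q k (us k)) \<longlonglongrightarrow> quad_model T \<beta> \<Lambda> w u" if "us \<longlonglongrightarrow> u" for us u
    unfolding q_def quad_model_def by (intro tendsto_intros Tlim that \<Lambda>s ws)
  have upper: "f (xs k) \<le> f y + ereal (q k y - q k (xs k))" for k y
    using min[of k y] nonneg[of "xs k"] nonneg[of y] unfolding q_def[symmetric]
    by (cases "f (xs k)"; cases "f y") auto
  have limsup: "limsup (\<lambda>k. f (xs k)) \<le> f y + ereal (quad_model T \<beta> \<Lambda> w y - quad_model T \<beta> \<Lambda> w x)"
    for y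
  proof -
    have "(\<lambda>k. q k y - q k (xs k)) \<longlonglongrightarrow> quad_model T \<beta> \<Lambda> w y - quad_model T \<beta> \<Lambda> w x"
      by (intro tendsto_diff qlim xs tendsto_const)
    then have "(\<lambda>k. f y + ereal (q k y - q k (xs k)))
        \<longlonglongrightarrow> f y + ereal (quad_model T \<beta> \<Lambda> w y - quad_model T \<beta> \<Lambda> w x)"
      using nonneg[of y] by (intro tendsto_add_ereal_general tendsto_const) auto
    then have "limsup (\<lambda>k. f y + ereal (q k y - q k (xs k)))
        = f y + ereal (quad_model T \<beta> \<Lambda> w y - quad_model T \<beta> \<Lambda> w x)"
      by (intro lim_imp_Limsup) auto
    moreover have "limsup (\<lambda>k. f (xs k)) \<le> limsup (\<lambda>k. f y + ereal (q k y - q k (xs k)))"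
      using upper by (intro Limsup_mono) auto
    ultimately show ?thesis by simp
  qed
  have lower: "f x \<le> liminf (\<lambda>k. f (xs k))" by (rule lsc_fun_liminf_le[OF lsc xs])
  have inf_sup: "liminf (\<lambda>k. f (xs k)) \<le> limsup (\<lambda>k. f (xs k))"
    by (intro Liminf_le_Limsup) auto
  \<comment> \<open>The competitor \<open>y = xs 0\<close> has a finite value, which bounds the
    limsup and hence \<open>f x\<close>.\<close>
  have fin_x: "f x < \<infinity>"
    using order_trans[OF lower order_trans[OF inf_sup limsup[of "xs 0"]]] fin[of 0]
    by (cases "f (xs 0)") auto
  have lim_f: "(\<lambda>k. f (xs k)) \<longlonglongrightarrow> f x"
  proof (rule Liminf_eq_Limsup)
    \<comment> \<open>With the competitor \<open>y = x\<close> the two model values cancel.\<close>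
    have "limsup (\<lambda>k. f (xs k)) \<le> f x"
      using limsup[of x] by (cases "f x") auto
    then show "liminf (\<lambda>k. f (xs k)) = f x" "limsup (\<lambda>k. f (xs k)) = f x"
      using lower inf_sup by auto
  qed auto
  have "(\<lambda>k. adjoint T (\<Lambda>s k - \<beta> *\<^sub>R (T (xs k) + ws k))) \<longlonglongrightarrow> adjoint T (\<Lambda> - \<beta> *\<^sub>R (T x + w))"
    using adjoint_linear[OF lin, unfolded linear_conv_bounded_linear]
    by (rule bounded_linear.tendsto) (intro tendsto_intros Tlim xs \<Lambda>s ws)
  moreover have "adjoint T (\<Lambda>s k - \<beta> *\<^sub>R (T (xs k) + ws k)) \<in> frechet_subdiff f (xs k)" for k
    by (rule frechet_subdiff_of_quadratic_minimizer) (use assms in auto)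
  ultimately show ?thesis
    unfolding limiting_subdiff_def eff_dom_def using fin_x xs lim_f by blast
qed

subsection \<open>Inequalities and null sequences\<close>

lemma norm_sq_convex_combination_le:
  fixes x y :: "'a::real_inner"
  assumes "0 \<le> \<mu>" "\<mu> \<le> 1"
  shows "(norm ((1 - \<mu>) *\<^sub>R x + \<mu> *\<^sub>R y))\<^sup>2 \<le> (1 - \<mu>) * (norm x)\<^sup>2 + \<mu> * (norm y)\<^sup>2"
proof -
  have "(1 - \<mu>) * (norm x)\<^sup>2 + \<mu> * (norm y)\<^sup>2 - (norm ((1 - \<mu>) *\<^sub>R x + \<mu> *\<^sub>R y))\<^sup>2
      = \<mu> * (1 - \<mu>) * (norm (x - y))\<^sup>2"
    unfolding power2_norm_eq_inner by (simp add: algebra_simps inner_commute)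
  also have "\<dots> \<ge> 0" using assms by simp
  finally show ?thesis by simp
qed

text \<open>Factor the quadratic at its roots (1 + sqrt 5) / 2 and (1 - sqrt 5) / 2.\<close>

lemma golden_ratio_bound:
  assumes "0 < \<tau>" "\<tau> < (1 + sqrt 5) / 2"
  shows "0 < 1 + \<tau> - \<tau>\<^sup>2"
proof -
  have "0 < ((1 + sqrt 5) / 2 - \<tau>) * (\<tau> + (sqrt 5 - 1) / 2)"
    using assms by (intro mult_pos_pos add_pos_pos) auto
  also have "\<dots> = 1 + \<tau> - \<tau>\<^sup>2" by (simp add: field_simps power2_eq_square)
  finally show ?thesis .
qed

text \<open>For \<open>\<tau> \<le> 1\<close> the left-hand side is a convex combination of \<open>a\<close> and \<open>b\<close>; for \<open>\<tau> > 1\<close> it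
  is one of \<open>- \<tau> a\<close> and \<open>\<tau>\<^sup>2 b\<close>, with weight \<open>1 / \<tau>\<close>.\<close>

lemma relaxed_step_bound:
  assumes tau: "0 < \<tau>" "\<tau> < (1 + sqrt 5) / 2"
  shows "\<exists>q p. 0 \<le> q \<and> q < 1 \<and> 0 \<le> p \<and> q * \<tau> = theta \<tau> * (1 - q) \<and>
    p \<le> max (1 / \<tau>) (\<tau>\<^sup>2 / (1 + \<tau> - \<tau>\<^sup>2)) * \<tau> * (1 - q) \<and>
    (\<forall>a b :: 'a::real_inner.
      (norm ((1 - \<tau>) *\<^sub>R a + \<tau> *\<^sub>R b))\<^sup>2 \<le> q * (norm a)\<^sup>2 + p * (norm b)\<^sup>2)"
proof (cases "\<tau> \<le> 1")
  case True
  have "(\<tau> - 1) * \<tau>\<^sup>2 / (1 + \<tau> - \<tau>\<^sup>2) \<le> 0"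
    using True golden_ratio_bound[OF tau] by (simp add: divide_nonpos_pos mult_nonpos_nonneg)
  then have theta: "theta \<tau> = 1 - \<tau>" using True by (simp add: theta_def)
  have "1 / \<tau> * \<tau>\<^sup>2 \<le> max (1 / \<tau>) (\<tau>\<^sup>2 / (1 + \<tau> - \<tau>\<^sup>2)) * \<tau>\<^sup>2"
    by (intro mult_right_mono) auto
  \<comment> \<open>The witnesses are \<open>q = 1 - \<tau>\<close> and
    \<open>p = \<tau>\<close>.\<close>
  then show ?thesis
    using True tau theta norm_sq_convex_combination_le[where 'a='a, of \<tau>]
    by (intro exI[of _ "1 - \<tau>"] exI[of _ \<tau>]) (auto simp: power2_eq_square)
next
  case False
  let ?g = "1 + \<tau> - \<tau>\<^sup>2"
  have g: "0 < ?g" by (rule golden_ratio_bound[OF tau])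
  have "1 - \<tau> \<le> 0" "0 \<le> (\<tau> - 1) * \<tau>\<^sup>2 / ?g" using False g by auto
  then have theta: "theta \<tau> = (\<tau> - 1) * \<tau>\<^sup>2 / ?g" by (simp add: theta_def)
  \<comment> \<open>Here \<open>q = \<tau> * (\<tau> - 1)\<close> and \<open>p = \<tau> ^ 3\<close>;
    \<open>q < 1\<close> is exactly the golden ratio condition.\<close>
  have q: "1 - \<tau> * (\<tau> - 1) = ?g" by (simp add: power2_eq_square algebra_simps)
  have "\<tau>\<^sup>2 / ?g * (\<tau> * ?g) \<le> max (1 / \<tau>) (\<tau>\<^sup>2 / ?g) * (\<tau> * ?g)"
    using tau g by (intro mult_right_mono) auto
  then have p: "\<tau> ^ 3 \<le> max (1 / \<tau>) (\<tau>\<^sup>2 / ?g) * \<tau> * ?g"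
    using g by (simp add: power2_eq_square power3_eq_cube mult.assoc)
  have "(norm ((1 - \<tau>) *\<^sub>R a + \<tau> *\<^sub>R b))\<^sup>2 \<le> \<tau> * (\<tau> - 1) * (norm a)\<^sup>2 + \<tau> ^ 3 * (norm b)\<^sup>2"
    for a b :: 'a
  proof -
    have eq: "(1 - \<tau>) *\<^sub>R a + \<tau> *\<^sub>R b
        = (1 - 1 / \<tau>) *\<^sub>R ((- \<tau>) *\<^sub>R a) + (1 / \<tau>) *\<^sub>R (\<tau>\<^sup>2 *\<^sub>R b)"
      using tau by (simp add: algebra_simps power2_eq_square)
    have "(norm ((1 - \<tau>) *\<^sub>R a + \<tau> *\<^sub>R b))\<^sup>2
        \<le> (1 - 1 / \<tau>) * (norm ((- \<tau>) *\<^sub>R a))\<^sup>2 + 1 / \<tau> * (norm (\<tau>\<^sup>2 *\<^sub>R b))\<^sup>2"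
      unfolding eq by (rule norm_sq_convex_combination_le) (use False in auto)
    also have "\<dots> = \<tau> * (\<tau> - 1) * (norm a)\<^sup>2 + \<tau> ^ 3 * (norm b)\<^sup>2"
      using tau by (simp add: power_mult_distrib field_simps power2_eq_square power3_eq_cube)
    finally show ?thesis .
  qed
  moreover have "0 \<le> \<tau> * (\<tau> - 1)" "\<tau> * (\<tau> - 1) < 1" "0 \<le> \<tau> ^ 3"
    using False tau g q by auto
  moreover have "\<tau> * (\<tau> - 1) * \<tau> = theta \<tau> * (1 - \<tau> * (\<tau> - 1))"
    unfolding q theta using g by (simp add: power2_eq_square)
  ultimately show ?thesis
    using p unfolding q[symmetric] by blast
qed

text \<open>\<open>V\<close> decreases and is bounded below, so it converges; \<open>d\<close> is
  squeezed between 0 and the successive drops of \<open>V\<close>.\<close>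

lemma decrease_tendsto_0:
  fixes V d :: "nat \<Rightarrow> real"
  assumes nonneg: "\<And>k. 0 \<le> V k" "\<And>k. 0 \<le> d k" and dec: "\<And>k. V (Suc k) \<le> V k - d k"
  shows "d \<longlonglongrightarrow> 0"
proof -
  have "decseq V"
    by (rule decseq_SucI) (use nonneg(2) dec in \<open>smt (verit)\<close>)
  then obtain l where l: "V \<longlonglongrightarrow> l" using decseq_convergent nonneg(1) by metis
  then have "(\<lambda>k. V k - V (Suc k)) \<longlonglongrightarrow> l - l"
    by (intro tendsto_diff) (simp_all add: filterlim_sequentially_Suc)
  then have lim: "(\<lambda>k. V k - V (Suc k)) \<longlonglongrightarrow> 0" by simp
  have le: "d k \<le> V k - V (Suc k)" for k using dec[of k] by simp
  show ?thesis
    by (rule tendsto_sandwich[OF _ _ tendsto_const lim]) (use nonneg(2) le in auto)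
qed

subsection \<open>The ADMM iteration\<close>

text \<open>The real-valued part of the augmented Lagrangian, split off so that it can be handled by
  real arithmetic instead of \<open>ereal\<close>.\<close>

definition coupling ::
  "('a::euclidean_space \<Rightarrow> 'a) \<Rightarrow> ('a \<Rightarrow> 'a) \<Rightarrow> ('a \<Rightarrow> 'a) \<Rightarrow> 'a \<Rightarrow> real \<Rightarrow> 'a \<Rightarrow> 'a \<Rightarrow> 'a \<Rightarrow> 'a \<Rightarrow> real" where
  "coupling A B C D \<beta> L S Z \<Lambda> =
     1/2 * (norm (D - A Z))\<^sup>2 - \<Lambda> \<bullet> (B L + C S - Z) + \<beta>/2 * (norm (B L + C S - Z))\<^sup>2"

lemma aug_lagrangian_coupling:
  "aug_lagrangian \<Psi> \<Phi> A B C D \<beta> L S Z \<Lambda> = \<Psi> L + \<Phi> S + ereal (coupling A B C D \<beta> L S Z \<Lambda>)"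
  by (simp add: aug_lagrangian_def coupling_def)

lemma coupling_L:
  "coupling A B C D \<beta> L S Z \<Lambda> = 1/2 * (norm (D - A Z))\<^sup>2 + quad_model B \<beta> \<Lambda> (C S - Z) L"
  by (simp add: coupling_def quad_model_def algebra_simps)

lemma coupling_S:
  "coupling A B C D \<beta> L S Z \<Lambda> = 1/2 * (norm (D - A Z))\<^sup>2 + quad_model C \<beta> \<Lambda> (B L - Z) S"
  by (simp add: coupling_def quad_model_def algebra_simps)

text \<open>The parallelogram law: strong convexity in the direction of \<open>T\<close>, with a
  surplus that \<open>L_step_decrease\<close> exploits.\<close>

lemma quad_model_midpoint:
  assumes lin: "linear T"
  shows "quad_model T \<beta> \<Lambda> w ((1 / 2) *\<^sub>R x + (1 / 2) *\<^sub>R y)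
    = (quad_model T \<beta> \<Lambda> w x + quad_model T \<beta> \<Lambda> w y) / 2 - \<beta> / 8 * (norm (T (x - y)))\<^sup>2"
  unfolding quad_model_def power2_norm_eq_inner
  using lin by (simp add: linear_add linear_scale linear_diff inner_add inner_diff inner_commute)
    (simp add: field_simps)

lemma coupling_Z_expansion:
  assumes lin: "linear A"
  shows "coupling A B C D \<beta> L S (Z + V) \<Lambda> = coupling A B C D \<beta> L S Z \<Lambda>
    + V \<bullet> (adjoint A (A Z - D) + \<Lambda> - \<beta> *\<^sub>R (B L + C S - Z))
    + (1/2 * (norm (A V))\<^sup>2 + \<beta>/2 * (norm V)\<^sup>2)"
proof -
  have "V \<bullet> adjoint A (A Z - D) = A V \<bullet> (A Z - D)" by (rule adjoint_works[OF lin])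
  then show ?thesis unfolding coupling_def power2_norm_eq_inner
    using lin by (simp add: linear_add algebra_simps inner_commute)
qed

lemma is_arg_min_le:
  fixes f :: "'a \<Rightarrow> 'b::linorder"
  shows "is_arg_min f (\<lambda>_. True) x \<Longrightarrow> f x \<le> f y"
  by (simp add: is_arg_min_linorder)

text \<open>A linear left inverse is continuous in finite dimension.\<close>

lemma linear_inj_tendsto_0D:
  fixes T :: "'a::euclidean_space \<Rightarrow> 'b::euclidean_space"
  assumes "linear T" "inj T" "(\<lambda>k. T (f k)) \<longlonglongrightarrow> 0"
  shows "f \<longlonglongrightarrow> 0"
proof -
  obtain g where "linear g" "g \<circ> T = id"
    using linear_injective_left_inverse assms(1,2) by blast
  then have "(\<lambda>k. g (T (f k))) \<longlonglongrightarrow> g 0"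
    using assms(3) linear_conv_bounded_linear bounded_linear.tendsto by blast
  then show ?thesis using \<open>linear g\<close> \<open>g \<circ> T = id\<close> by (simp add: linear_0 pointfree_idE)
qed

locale admm_iterates =
  fixes \<Psi> \<Phi> :: "'a::euclidean_space \<Rightarrow> ereal"
    and A B C :: "'a \<Rightarrow> 'a"
    and D :: 'a
    and \<tau> \<beta> :: real
    and L S Z \<Lambda> :: "nat \<Rightarrow> 'a"
  assumes Psi: "lsc_fun \<Psi>" "\<And>X. 0 \<le> \<Psi> X" "convex_fun \<Psi>"
    and Phi: "lsc_fun \<Phi>" "\<And>X. 0 \<le> \<Phi> X"
    and lin: "linear A" "linear B" "linear C"
    and inj: "inj B" "inj C"
    and tau: "0 < \<tau>" "\<tau> < (1 + sqrt 5) / 2"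
    and beta: "0 < \<beta>" "beta_bar A \<tau> < \<beta>"
    and admm: "admm_sequence \<Psi> \<Phi> A B C D \<tau> \<beta> L S Z \<Lambda>"
    and start: "potential \<Psi> \<Phi> A B C D \<tau> \<beta> (L 1) (S 1) (Z 1) (\<Lambda> 1) < \<infinity>"
begin

abbreviation "lag \<equiv> aug_lagrangian \<Psi> \<Phi> A B C D \<beta>"
abbreviation "cpl \<equiv> coupling A B C D \<beta>"
abbreviation "lmax \<equiv> lambda_max (adjoint A \<circ> A)"
abbreviation "lmin \<equiv> lambda_min (adjoint A \<circ> A)"
abbreviation "res k \<equiv> B (L k) + C (S k) - Z k"
abbreviation "grad k \<equiv> adjoint A (A (Z k) - D)"

section \<open>Finiteness of the values and optimality of the block steps\<close>

lemma argmin: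
  "lag (L (Suc k)) (S k) (Z k) (\<Lambda> k) \<le> lag X (S k) (Z k) (\<Lambda> k)"
  "lag (L (Suc k)) (S (Suc k)) (Z k) (\<Lambda> k) \<le> lag (L (Suc k)) X (Z k) (\<Lambda> k)"
  "lag (L (Suc k)) (S (Suc k)) (Z (Suc k)) (\<Lambda> k) \<le> lag (L (Suc k)) (S (Suc k)) X (\<Lambda> k)"
  using admm unfolding admm_sequence_def
  by (blast intro: is_arg_min_le[where f="\<lambda>X. lag X (S k) (Z k) (\<Lambda> k)"]
    is_arg_min_le[where f="\<lambda>X. lag (L (Suc k)) X (Z k) (\<Lambda> k)"]
    is_arg_min_le[where f="\<lambda>X. lag (L (Suc k)) (S (Suc k)) X (\<Lambda> k)"])+

lemma dual_step: "\<Lambda> (Suc k) = \<Lambda> k - (\<tau> * \<beta>) *\<^sub>R res (Suc k)"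
  using admm by (simp add: admm_sequence_def)

lemma lag_finite_iff: "lag X Y W V < \<infinity> \<longleftrightarrow> \<Psi> X < \<infinity> \<and> \<Phi> Y < \<infinity>"
  using Psi(2)[of X] Phi(2)[of Y] unfolding aug_lagrangian_coupling
  by (cases "\<Psi> X"; cases "\<Phi> Y") auto

text \<open>The first iterate is finite by \<open>start\<close>, since minimality alone permits an
  infinite first minimum. Afterwards each block minimum is at most the finite value at the previous
  block.\<close>

lemma finite_values: "\<Psi> (L (Suc k)) < \<infinity> \<and> \<Phi> (S (Suc k)) < \<infinity>"
proof (induction k)
  case 0
  have "lag (L 1) (S 1) (Z 1) (\<Lambda> 1) < \<infinity>"
    using start by (simp add: potential_def)
  then show ?case unfolding lag_finite_iff by simp
next
  case (Suc k)
  have "lag (L (Suc (Suc k))) (S (Suc k)) (Z (Suc k)) (\<Lambda> (Suc k)) < \<infinity>"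
    by (rule le_less_trans[OF argmin(1)[of _ "L (Suc k)"]]) (simp only: lag_finite_iff Suc)
  then have "lag (L (Suc (Suc k))) (S (Suc (Suc k))) (Z (Suc k)) (\<Lambda> (Suc k)) < \<infinity>"
    by (rule le_less_trans[OF argmin(2)])
  then show ?case by (simp only: lag_finite_iff)
qed

text \<open>The index is shifted by one because the values are known to be finite only from the first
  iterate on.\<close>

definition psi :: "nat \<Rightarrow> real" where "psi k = real_of_ereal (\<Psi> (L (Suc k)))"
definition phi :: "nat \<Rightarrow> real" where "phi k = real_of_ereal (\<Phi> (S (Suc k)))"

lemma Psi_L: "\<Psi> (L (Suc k)) = ereal (psi k)" and Phi_S: "\<Phi> (S (Suc k)) = ereal (phi k)"
  using finite_values[of k] Psi(2)[of "L (Suc k)"] Phi(2)[of "S (Suc k)"]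
  unfolding psi_def phi_def by (auto simp: ereal_real)

lemma psi_nonneg: "0 \<le> psi k" and phi_nonneg: "0 \<le> phi k"
  using Psi(2)[of "L (Suc k)"] Phi(2)[of "S (Suc k)"] by (simp_all add: Psi_L Phi_S)

text \<open>The fixed value \<open>\<Phi> (S (Suc k))\<close> is finite and cancels. Hence the index
  starts at the second \<open>L\<close>-step, whereas \<open>S_minimizer\<close> can start at the
  first \<open>S\<close>-step.\<close>

lemma L_minimizer:
  "\<Psi> (L (Suc (Suc k))) + ereal (quad_model B \<beta> (\<Lambda> (Suc k)) (C (S (Suc k)) - Z (Suc k)) (L (Suc (Suc k))))
    \<le> \<Psi> X + ereal (quad_model B \<beta> (\<Lambda> (Suc k)) (C (S (Suc k)) - Z (Suc k)) X)"
  using argmin(1)[of "Suc k" X] Psi(2)[of X] unfolding aug_lagrangian_coupling coupling_L Psi_L Phi_S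
  by (cases "\<Psi> X") auto

lemma S_minimizer:
  "\<Phi> (S (Suc k)) + ereal (quad_model C \<beta> (\<Lambda> k) (B (L (Suc k)) - Z k) (S (Suc k)))
    \<le> \<Phi> X + ereal (quad_model C \<beta> (\<Lambda> k) (B (L (Suc k)) - Z k) X)"
  using argmin(2)[of k X] Phi(2)[of X] unfolding aug_lagrangian_coupling coupling_S Psi_L Phi_S
  by (cases "\<Phi> X") auto

section \<open>Change of the augmented Lagrangian in each step\<close>

text \<open>The competitor is the midpoint of the old and new \<open>L\<close>: convexity of
  \<open>\<Psi>\<close> halves the difference of values, and the surplus \<beta>/8 of
  \<open>quad_model_midpoint\<close> doubles to \<beta>/4.\<close>

lemma L_step_decrease:
  "psi (Suc k) + cpl (L (Suc (Suc k))) (S (Suc k)) (Z (Suc k)) (\<Lambda> (Suc k))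
      + \<beta> / 4 * (norm (B (L (Suc (Suc k)) - L (Suc k))))\<^sup>2
    \<le> psi k + cpl (L (Suc k)) (S (Suc k)) (Z (Suc k)) (\<Lambda> (Suc k))"
proof -
  define x y where "x = L (Suc (Suc k))" and "y = L (Suc k)"
  let ?q = "quad_model B \<beta> (\<Lambda> (Suc k)) (C (S (Suc k)) - Z (Suc k))"
  define m where "m = (1/2) *\<^sub>R x + (1/2) *\<^sub>R y"
  have "\<forall>t\<in>{0<..<1}. \<Psi> ((1 - t) *\<^sub>R x + t *\<^sub>R y) \<le> ereal (1 - t) * \<Psi> x + ereal t * \<Psi> y"
    using Psi(3) by (auto simp: convex_fun_def)
  from bspec[OF this, of "1/2"] have "\<Psi> m \<le> ereal ((psi (Suc k) + psi k) / 2)"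
    by (simp add: m_def x_def y_def Psi_L add_divide_distrib)
  then have "\<Psi> m + ereal (?q m) \<le> ereal ((psi (Suc k) + psi k) / 2) + ereal (?q m)"
    by (rule add_right_mono)
  moreover have "ereal (psi (Suc k)) + ereal (?q x) \<le> \<Psi> m + ereal (?q m)"
    using L_minimizer[of k m] by (simp add: Psi_L x_def)
  ultimately have "ereal (psi (Suc k)) + ereal (?q x) \<le> ereal ((psi (Suc k) + psi k) / 2) + ereal (?q m)"
    by (rule order_trans[rotated])
  then have "psi (Suc k) + ?q x \<le> (psi (Suc k) + psi k) / 2 + ?q m" by simp
  then show ?thesis
    using quad_model_midpoint[OF lin(2), of \<beta> "\<Lambda> (Suc k)" "C (S (Suc k)) - Z (Suc k)" x y]
    unfolding m_def[symmetric] x_def[symmetric] y_def[symmetric] coupling_L by (simp add: field_simps)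
qed

text \<open>Comparison with the old \<open>S\<close> gives no quadratic surplus; the increments of
  \<open>S\<close> are recovered later from those of \<open>L\<close>, \<open>Z\<close> and the
  residual.\<close>

lemma S_step_decrease:
  "phi (Suc k) + cpl (L (Suc (Suc k))) (S (Suc (Suc k))) (Z (Suc k)) (\<Lambda> (Suc k))
    \<le> phi k + cpl (L (Suc (Suc k))) (S (Suc k)) (Z (Suc k)) (\<Lambda> (Suc k))"
  using S_minimizer[of "Suc k" "S (Suc k)"] by (simp add: Phi_S coupling_S)

text \<open>Moving \<open>Z\<close> along the partial gradient \<open>G\<close> changes the value by
  a quadratic in \<open>t\<close> with linear coefficient |G|^2, so minimality forces
  \<open>G = 0\<close>.\<close>

lemma Z_step_optimality: "\<beta> *\<^sub>R res (Suc k) = \<Lambda> k + grad (Suc k)"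
proof -
  define G where "G = grad (Suc k) + \<Lambda> k - \<beta> *\<^sub>R res (Suc k)"
  have min: "cpl (L (Suc k)) (S (Suc k)) (Z (Suc k)) (\<Lambda> k) \<le> cpl (L (Suc k)) (S (Suc k)) X (\<Lambda> k)" for X
    using argmin(3)[of k X] by (simp add: aug_lagrangian_coupling Psi_L Phi_S)
  have "G \<bullet> G = 0"
  proof (rule linear_coeff_eq_0_if_quadratic_nonneg)
    fix t :: real
    show "0 \<le> t * (G \<bullet> G) + t\<^sup>2 * (1/2 * (norm (A G))\<^sup>2 + \<beta>/2 * (norm G)\<^sup>2)"
      using min[of "Z (Suc k) + t *\<^sub>R G"]
      unfolding coupling_Z_expansion[OF lin(1)] G_def[symmetric]
      by (simp add: linear_scale[OF lin(1)] power_mult_distrib algebra_simps)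
  qed
  then have "G = 0" by simp
  then show ?thesis by (simp add: G_def algebra_simps)
qed

text \<open>At the minimizer the linear term of the expansion vanishes; \<open>lmin\<close> bounds
  the remaining quadratic term from below.\<close>

lemma Z_step_decrease:
  "cpl (L (Suc k)) (S (Suc k)) (Z (Suc k)) (\<Lambda> k) + (lmin + \<beta>) / 2 * (norm (Z (Suc k) - Z k))\<^sup>2
    \<le> cpl (L (Suc k)) (S (Suc k)) (Z k) (\<Lambda> k)"
proof -
  have "cpl (L (Suc k)) (S (Suc k)) (Z (Suc k) + (Z k - Z (Suc k))) (\<Lambda> k)
      = cpl (L (Suc k)) (S (Suc k)) (Z (Suc k)) (\<Lambda> k)
        + (1/2 * (norm (A (Z k - Z (Suc k))))\<^sup>2 + \<beta>/2 * (norm (Z k - Z (Suc k)))\<^sup>2)"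
    unfolding coupling_Z_expansion[OF lin(1)] by (simp add: Z_step_optimality)
  then show ?thesis
    using lambda_min_le_norm_sq[OF lin(1), of "Z k - Z (Suc k)"]
    by (simp add: norm_minus_commute field_simps)
qed

lemma dual_step_increase:
  "cpl X Y (Z (Suc k)) (\<Lambda> (Suc k)) = cpl X Y (Z (Suc k)) (\<Lambda> k)
    + \<tau> * \<beta> * (res (Suc k) \<bullet> (B X + C Y - Z (Suc k)))"
  unfolding coupling_def dual_step by (simp add: algebra_simps)

lemma multiplier_eq: "\<Lambda> (Suc k) = (\<beta> - \<tau> * \<beta>) *\<^sub>R res (Suc k) - grad (Suc k)"
proof -
  have "a - x = a + g - x - g" for a x g :: 'a by simp
  then show ?thesis unfolding dual_step scaleR_left_diff_distrib Z_step_optimality .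
qed

text \<open>Subtract two consecutive \<open>Z\<close>-step conditions after eliminating the
  multiplier. The factor \<open>\<tau>\<close> is pulled out to match the shape
  \<open>(1 - \<tau>) *\<^sub>R a + \<tau> *\<^sub>R b\<close> of
  \<open>relaxed_step_bound\<close>.\<close>

lemma residual_recurrence:
  "res (Suc (Suc k)) = (1 - \<tau>) *\<^sub>R res (Suc k)
     + \<tau> *\<^sub>R ((1 / (\<tau> * \<beta>)) *\<^sub>R adjoint A (A (Z (Suc (Suc k)) - Z (Suc k))))"
proof -
  have "grad (Suc (Suc k)) - grad (Suc k) = adjoint A (A (Z (Suc (Suc k)) - Z (Suc k)))"
    using linear_diff[OF adjoint_linear[OF lin(1)]] linear_diff[OF lin(1)]
    by (metis (no_types, lifting) diff_diff_eq2 diff_add_cancel)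
  moreover have "\<beta> *\<^sub>R res (Suc (Suc k)) = (\<beta> - \<tau> * \<beta>) *\<^sub>R res (Suc k) + (grad (Suc (Suc k)) - grad (Suc k))"
    unfolding Z_step_optimality[of "Suc k"] multiplier_eq by simp
  ultimately have "(1 / \<beta>) *\<^sub>R (\<beta> *\<^sub>R res (Suc (Suc k)))
      = (1 / \<beta>) *\<^sub>R ((\<beta> - \<tau> * \<beta>) *\<^sub>R res (Suc k) + adjoint A (A (Z (Suc (Suc k)) - Z (Suc k))))"
    by simp
  moreover have "(1 / \<beta>) * (\<beta> - \<tau> * \<beta>) = 1 - \<tau>" using beta(1) by (simp add: field_simps)
  ultimately show ?thesis using beta(1) tau(1) by (simp add: scaleR_add_right del: scaleR_diff_right)
qed

section \<open>Lower bound and decrease of the potential\<close>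

text \<open>This is \<open>potential\<close> at iterate \<open>Suc k\<close>, as a real
  number.\<close>

definition merit :: "nat \<Rightarrow> real" where
  "merit k = psi k + phi k + cpl (L (Suc k)) (S (Suc k)) (Z (Suc k)) (\<Lambda> (Suc k))
     + theta \<tau> * \<beta> * (norm (res (Suc k)))\<^sup>2"

lemma beta_gt_lmax: "lmax < \<beta>"
proof -
  have "1 \<le> max (1 / \<tau>) \<tau>" using tau(1) by (cases "\<tau> \<le> 1") (auto simp: le_max_iff_disj)
  then have "1 * lmax \<le> max (1 / \<tau>) \<tau> * lmax"
    by (rule mult_right_mono) (rule lambda_max_adjoint_comp_nonneg[OF lin(1)])
  then show ?thesis using beta(2) by (simp add: beta_bar_def Let_def)
qed

text \<open>The second entry of \<open>beta_bar\<close> is the larger root of \<beta>^2 + lmin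
  \<beta> - 2 \<kappa> lmax^2, with \<kappa> the maximum in the statement.\<close>

lemma beta_quadratic:
  "max (1 / \<tau>) (\<tau>\<^sup>2 / (1 + \<tau> - \<tau>\<^sup>2)) * lmax\<^sup>2 / \<beta> < (lmin + \<beta>) / 2"
proof -
  define \<kappa> where "\<kappa> = max (1 / \<tau>) (\<tau>\<^sup>2 / (1 + \<tau> - \<tau>\<^sup>2))"
  have k: "0 \<le> \<kappa>" using tau(1) by (simp add: \<kappa>_def le_max_iff_disj)
  have "sqrt (lmin\<^sup>2 + \<kappa> * (8 * lmax\<^sup>2)) < 2 * \<beta> + lmin"
    using beta(2) by (simp add: beta_bar_def Let_def \<kappa>_def)
  then have "(sqrt (lmin\<^sup>2 + \<kappa> * (8 * lmax\<^sup>2)))\<^sup>2 < (2 * \<beta> + lmin)\<^sup>2"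
    using k by (intro power_strict_mono) auto
  then have "lmin\<^sup>2 + \<kappa> * (8 * lmax\<^sup>2) < (2 * \<beta> + lmin)\<^sup>2" using k by simp
  then have "\<kappa> * lmax\<^sup>2 * 2 < (lmin + \<beta>) * \<beta>"
    by (simp add: power2_eq_square algebra_simps)
  then show ?thesis using beta(1) by (simp add: \<kappa>_def[symmetric] divide_simps algebra_simps)
qed

text \<open>With \<open>\<Lambda>\<close> eliminated, the coupling is half of |e + A r|^2 + (\<beta>
  |r|^2 - |A r|^2), minus (1 - \<tau>) \<beta> |r|^2. The bracket is nonnegative as
  \<open>lmax < \<beta>\<close>, and \<open>theta \<tau>\<close>, being at least
  \<open>1 - \<tau>\<close>, absorbs the last term.\<close>

lemma merit_nonneg: "0 \<le> merit k"
proof -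
  let ?r = "res (Suc k)" and ?e = "A (Z (Suc k)) - D"
  have "\<Lambda> (Suc k) \<bullet> ?r = (1 - \<tau>) * \<beta> * (norm ?r)\<^sup>2 - grad (Suc k) \<bullet> ?r"
    unfolding multiplier_eq inner_diff_left power2_norm_eq_inner inner_scaleR_left
    by (simp only: left_diff_distrib mult_1)
  moreover have "grad (Suc k) \<bullet> ?r = ?e \<bullet> A ?r"
    using adjoint_works[OF lin(1), of ?r ?e] by (simp add: inner_commute)
  ultimately have cpl: "cpl (L (Suc k)) (S (Suc k)) (Z (Suc k)) (\<Lambda> (Suc k))
      = 1/2 * (norm ?e)\<^sup>2 - (1 - \<tau>) * \<beta> * (norm ?r)\<^sup>2 + ?e \<bullet> A ?r + \<beta> / 2 * (norm ?r)\<^sup>2"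
    by (simp add: coupling_def norm_minus_commute)
  have sq: "(norm (?e + A ?r))\<^sup>2 = (norm ?e)\<^sup>2 + 2 * (?e \<bullet> A ?r) + (norm (A ?r))\<^sup>2"
    unfolding power2_norm_eq_inner by (simp add: inner_add inner_commute)
  have "(norm (A ?r))\<^sup>2 \<le> lmax * (norm ?r)\<^sup>2" by (rule norm_sq_le_lambda_max[OF lin(1)])
  also have "\<dots> \<le> \<beta> * (norm ?r)\<^sup>2" using beta_gt_lmax by (intro mult_right_mono) auto
  finally have A: "(norm (A ?r))\<^sup>2 \<le> \<beta> * (norm ?r)\<^sup>2" .
  have "(1 - \<tau>) * \<beta> * (norm ?r)\<^sup>2 \<le> theta \<tau> * \<beta> * (norm ?r)\<^sup>2"
    using beta(1) by (intro mult_right_mono) (auto simp: theta_def)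
  then show ?thesis
    using cpl A sq zero_le_power2[of "norm (?e + A ?r)"] psi_nonneg[of k] phi_nonneg[of k]
    unfolding merit_def by linarith
qed

text \<open>Sum of the three block decreases and the dual increase; the residual terms on the right
  remain to be absorbed.\<close>

lemma merit_decrease:
  "merit (Suc k) + \<beta> / 4 * (norm (B (L (Suc (Suc k)) - L (Suc k))))\<^sup>2
      + (lmin + \<beta>) / 2 * (norm (Z (Suc (Suc k)) - Z (Suc k)))\<^sup>2
    \<le> merit k + \<tau> * \<beta> * (norm (res (Suc (Suc k))))\<^sup>2
      + theta \<tau> * \<beta> * ((norm (res (Suc (Suc k))))\<^sup>2 - (norm (res (Suc k)))\<^sup>2)"
  using L_step_decrease[of k] S_step_decrease[of k] Z_step_decrease[of "Suc k"]
    dual_step_increase[of "L (Suc (Suc k))" "S (Suc (Suc k))" "Suc k"]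
  unfolding merit_def power2_norm_eq_inner[of "res _"] right_diff_distrib by linarith

lemma differences_tendsto_0:
  "(\<lambda>k. B (L (Suc (Suc k)) - L (Suc k))) \<longlonglongrightarrow> 0"
  "(\<lambda>k. Z (Suc (Suc k)) - Z (Suc k)) \<longlonglongrightarrow> 0"
  "(\<lambda>k. res (Suc k)) \<longlonglongrightarrow> 0"
proof -
  define \<kappa> where "\<kappa> = max (1 / \<tau>) (\<tau>\<^sup>2 / (1 + \<tau> - \<tau>\<^sup>2))"
  obtain q p where q: "0 \<le> q" "q < 1" and p: "0 \<le> p" and qt: "q * \<tau> = theta \<tau> * (1 - q)"
    and pk: "p \<le> \<kappa> * \<tau> * (1 - q)"
    and step: "\<And>a b :: 'a. (norm ((1 - \<tau>) *\<^sub>R a + \<tau> *\<^sub>R b))\<^sup>2 \<le> q * (norm a)\<^sup>2 + p * (norm b)\<^sup>2"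
    using relaxed_step_bound[OF tau, where 'a='a] unfolding \<kappa>_def by blast
  define x where "x k = (norm (res (Suc k)))\<^sup>2" for k
  define z where "z k = (norm (Z (Suc (Suc k)) - Z (Suc k)))\<^sup>2" for k
  define l where "l k = (norm (B (L (Suc (Suc k)) - L (Suc k))))\<^sup>2" for k
  \<comment> \<open>\<open>c\<close> is the weight of \<open>z k\<close> in the bound for the next
    residual, \<open>\<delta>\<close> the margin left by \<open>beta_quadratic\<close>, and
    \<open>\<epsilon>\<close> is small enough that \<open>\<epsilon> * c\<close> costs at most half
    of it; the summand 1 keeps the divisor positive.\<close>
  define c where "c = p * lmax\<^sup>2 / (\<tau> * \<beta>)\<^sup>2"
  define \<delta> where "\<delta> = (lmin + \<beta>) / 2 - \<kappa> * lmax\<^sup>2 / \<beta>"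
  define \<epsilon> where "\<epsilon> = \<delta> / (2 * (c + 1))"
  have nonneg: "0 \<le> x k" "0 \<le> z k" "0 \<le> l k" for k by (auto simp: x_def z_def l_def)
  have c: "0 \<le> c" using p by (simp add: c_def)
  have \<delta>: "0 < \<delta>" using beta_quadratic by (simp add: \<delta>_def \<kappa>_def)
  have \<epsilon>: "0 < \<epsilon>" "\<epsilon> * c \<le> \<delta> / 2" using \<delta> c by (auto simp: \<epsilon>_def field_simps)
  have rec: "x (Suc k) \<le> q * x k + c * z k" for k
  proof -
    define v where "v = Z (Suc (Suc k)) - Z (Suc k)"
    have "x (Suc k) \<le> q * x k + p * (norm ((1 / (\<tau> * \<beta>)) *\<^sub>R adjoint A (A v)))\<^sup>2"
      unfolding x_def residual_recurrence[of k] v_def by (rule step)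
    also have "(norm ((1 / (\<tau> * \<beta>)) *\<^sub>R adjoint A (A v)))\<^sup>2 \<le> (1 / (\<tau> * \<beta>) * (lmax * norm v))\<^sup>2"
      using tau(1) beta(1) norm_adjoint_comp_le[OF lin(1), of v]
      by (intro power_mono) (auto simp: divide_right_mono)
    finally show ?thesis
      using p by (simp add: mult_left_mono c_def z_def v_def power_mult_distrib power_divide)
  qed
  \<comment> \<open>After multiplication by \<open>1 - q\<close>, the identity \<open>qt\<close>
    collapses the left-hand side, up to the factor \<open>\<beta>\<close>, to
    \<open>\<tau> * (x (Suc k) - q * x k)\<close>, which \<open>rec\<close> bounds.\<close>
  have theta_step: "\<tau> * \<beta> * x (Suc k) + theta \<tau> * \<beta> * (x (Suc k) - x k) \<le> \<kappa> * lmax\<^sup>2 / \<beta> * z k" for k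
  proof -
    have "(1 - q) * (\<tau> * x (Suc k) + theta \<tau> * (x (Suc k) - x k))
        = (1 - q) * \<tau> * x (Suc k) + (theta \<tau> * (1 - q)) * (x (Suc k) - x k)"
      by (simp add: algebra_simps)
    also have "\<dots> = \<tau> * (x (Suc k) - q * x k)"
      unfolding qt[symmetric] by (simp add: algebra_simps)
    also have "\<dots> \<le> \<tau> * (c * z k)" using tau(1) rec[of k] by (intro mult_left_mono) auto
    also have "\<dots> = p * (lmax\<^sup>2 * z k / (\<tau> * \<beta>\<^sup>2))"
      using tau(1) by (simp add: c_def power2_eq_square ac_simps)
    also have "\<dots> \<le> \<kappa> * \<tau> * (1 - q) * (lmax\<^sup>2 * z k / (\<tau> * \<beta>\<^sup>2))"
      using pk nonneg tau(1) by (intro mult_right_mono) auto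
    also have "\<dots> = (1 - q) * (\<kappa> * lmax\<^sup>2 * z k / \<beta>\<^sup>2)" using tau(1) by simp
    finally have "\<tau> * x (Suc k) + theta \<tau> * (x (Suc k) - x k) \<le> \<kappa> * lmax\<^sup>2 * z k / \<beta>\<^sup>2"
      by (rule mult_left_le_imp_le) (use q(2) in simp)
    then have "\<beta> * (\<tau> * x (Suc k) + theta \<tau> * (x (Suc k) - x k)) \<le> \<beta> * (\<kappa> * lmax\<^sup>2 * z k / \<beta>\<^sup>2)"
      using beta(1) by (intro mult_left_mono) auto
    then show ?thesis using beta(1) by (simp add: power2_eq_square algebra_simps)
  qed
  define d where "d k = \<beta> / 4 * l k + \<delta> / 2 * z k + \<epsilon> * (1 - q) * x k" for k
  have d_nonneg: "0 \<le> \<beta> / 4 * l k" "0 \<le> \<delta> / 2 * z k" "0 \<le> \<epsilon> * (1 - q) * x k" for k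
    using nonneg beta(1) \<delta> \<epsilon>(1) q(2) by auto
  have \<delta>_eq: "(lmin + \<beta>) / 2 * z k = \<kappa> * lmax\<^sup>2 / \<beta> * z k + 2 * (\<delta> / 2 * z k)" for k
  proof -
    have "(lmin + \<beta>) / 2 = \<kappa> * lmax\<^sup>2 / \<beta> + \<delta>" by (simp add: \<delta>_def)
    then show ?thesis by (simp add: distrib_right)
  qed
  have \<epsilon>_eq: "\<epsilon> * (q * x k + c * z k) = \<epsilon> * x k - \<epsilon> * (1 - q) * x k + \<epsilon> * c * z k" for k
    by (simp add: algebra_simps)
  \<comment> \<open>The Lyapunov function is \<open>merit k + \<epsilon> * x k\<close>; since
    \<open>q < 1\<close>, its extra term makes the residual itself part of the decrease.\<close>
  have "d \<longlonglongrightarrow> 0"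
  proof (rule decrease_tendsto_0)
    fix k
    show "0 \<le> merit k + \<epsilon> * x k" using merit_nonneg \<epsilon>(1) nonneg by simp
    show "0 \<le> d k" using d_nonneg[of k] by (simp add: d_def)
    have "\<epsilon> * x (Suc k) \<le> \<epsilon> * (q * x k + c * z k)"
      using \<epsilon>(1) rec[of k] by (intro mult_left_mono) auto
    moreover have "\<epsilon> * c * z k \<le> \<delta> / 2 * z k"
      using \<epsilon>(2) nonneg by (intro mult_right_mono) auto
    moreover have "merit (Suc k) + \<beta> / 4 * l k + (lmin + \<beta>) / 2 * z k
        \<le> merit k + \<tau> * \<beta> * x (Suc k) + theta \<tau> * \<beta> * (x (Suc k) - x k)"
      using merit_decrease[of k] by (simp only: x_def z_def l_def)
    ultimately show "merit (Suc k) + \<epsilon> * x (Suc k) \<le> (merit k + \<epsilon> * x k) - d k"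
      using theta_step[of k] \<delta>_eq[of k] \<epsilon>_eq[of k] unfolding d_def by linarith
  qed
  \<comment> \<open>The summands of \<open>d\<close> are nonnegative, so each of them is dominated
    by \<open>d\<close>.\<close>
  have part: "f \<longlonglongrightarrow> 0" if "\<And>k. 0 \<le> f k" "\<And>k. a * f k \<le> d k" "0 < a" for a :: real and f
  proof (rule tendsto_sandwich[OF _ _ tendsto_const])
    show "(\<lambda>k. d k / a) \<longlonglongrightarrow> 0" using \<open>d \<longlonglongrightarrow> 0\<close> by (rule tendsto_divide_zero)
    show "\<forall>\<^sub>F k in sequentially. f k \<le> d k / a"
      using that by (intro always_eventually) (simp add: pos_le_divide_eq mult.commute)
  qed (use that in auto)
  have sq: "f \<longlonglongrightarrow> 0" if "(\<lambda>k. (norm (f k))\<^sup>2) \<longlonglongrightarrow> 0" for f :: "nat \<Rightarrow> 'a"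
    using tendsto_real_sqrt[OF that] by (simp add: tendsto_norm_zero_iff)
  show "(\<lambda>k. B (L (Suc (Suc k)) - L (Suc k))) \<longlonglongrightarrow> 0"
    by (rule sq, fold l_def, rule part[of _ "\<beta> / 4"])
      (use nonneg d_nonneg beta(1) in \<open>auto simp: d_def add_nonneg_nonneg\<close>)
  show "(\<lambda>k. Z (Suc (Suc k)) - Z (Suc k)) \<longlonglongrightarrow> 0"
    by (rule sq, fold z_def, rule part[of _ "\<delta> / 2"])
      (use nonneg d_nonneg \<delta> in \<open>auto simp: d_def add_nonneg_nonneg\<close>)
  show "(\<lambda>k. res (Suc k)) \<longlonglongrightarrow> 0"
    by (rule sq, fold x_def, rule part[of _ "\<epsilon> * (1 - q)"])
      (use nonneg d_nonneg \<epsilon>(1) q(2) in \<open>auto simp: d_def add_nonneg_nonneg\<close>)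
qed

section \<open>Vanishing increments and stationarity of cluster points\<close>

text \<open>For \<open>S\<close>, the definition of the residual expresses the increment of
  \<open>C S\<close> through increments known to vanish; injectivity then removes
  \<open>C\<close>.\<close>

lemma successive_differences:
  "(\<lambda>k. L (Suc k) - L k) \<longlonglongrightarrow> 0" "(\<lambda>k. S (Suc k) - S k) \<longlonglongrightarrow> 0"
  "(\<lambda>k. Z (Suc k) - Z k) \<longlonglongrightarrow> 0" "(\<lambda>k. \<Lambda> (Suc k) - \<Lambda> k) \<longlonglongrightarrow> 0"
proof -
  have "(\<lambda>k. L (Suc (Suc k)) - L (Suc k)) \<longlonglongrightarrow> 0"
    by (rule linear_inj_tendsto_0D[OF lin(2) inj(1) differences_tendsto_0(1)])
  then show "(\<lambda>k. L (Suc k) - L k) \<longlonglongrightarrow> 0"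
    by (rule filterlim_sequentially_Suc[of "\<lambda>k. L (Suc k) - L k", THEN iffD1])
  show "(\<lambda>k. Z (Suc k) - Z k) \<longlonglongrightarrow> 0"
    using differences_tendsto_0(2)
    by (rule filterlim_sequentially_Suc[of "\<lambda>k. Z (Suc k) - Z k", THEN iffD1])
  have "(\<lambda>k. (res (Suc (Suc k)) - res (Suc k)) + (Z (Suc (Suc k)) - Z (Suc k))
      - B (L (Suc (Suc k)) - L (Suc k))) \<longlonglongrightarrow> (0 - 0) + 0 - 0"
    by (intro tendsto_intros differences_tendsto_0 differences_tendsto_0(3)[THEN LIMSEQ_Suc])
  moreover have "(res (Suc (Suc k)) - res (Suc k)) + (Z (Suc (Suc k)) - Z (Suc k))
      - B (L (Suc (Suc k)) - L (Suc k)) = C (S (Suc (Suc k)) - S (Suc k))" for k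
    using lin by (simp add: linear_diff)
  ultimately have "(\<lambda>k. C (S (Suc (Suc k)) - S (Suc k))) \<longlonglongrightarrow> 0" by simp
  then have "(\<lambda>k. S (Suc (Suc k)) - S (Suc k)) \<longlonglongrightarrow> 0"
    by (rule linear_inj_tendsto_0D[OF lin(3) inj(2)])
  then show "(\<lambda>k. S (Suc k) - S k) \<longlonglongrightarrow> 0"
    by (rule filterlim_sequentially_Suc[of "\<lambda>k. S (Suc k) - S k", THEN iffD1])
  have "(\<lambda>k. - (\<tau> * \<beta>) *\<^sub>R res (Suc k)) \<longlonglongrightarrow> - (\<tau> * \<beta>) *\<^sub>R 0"
    by (intro tendsto_intros differences_tendsto_0(3))
  then show "(\<lambda>k. \<Lambda> (Suc k) - \<Lambda> k) \<longlonglongrightarrow> 0"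
    by (simp add: dual_step del: scaleR_diff_right)
qed

lemma cluster_point_stationary:
  assumes "cluster_point (\<lambda>k. (L k, S k, Z k, \<Lambda> k)) (L', S', Z', \<Lambda>')"
  shows "stationary_point \<Psi> \<Phi> A B C D L' S'"
proof -
  obtain r where r: "strict_mono r" "(\<lambda>j. (L (r j), S (r j), Z (r j), \<Lambda> (r j))) \<longlonglongrightarrow> (L', S', Z', \<Lambda>')"
    using assms by (auto simp: cluster_point_def o_def)
  \<comment> \<open>Dropping the first term makes every selected index positive, hence of the form
    \<open>Suc (s j)\<close>, where the estimates apply.\<close>
  define s where "s j = r (Suc j) - 1" for j
  have "Suc j \<le> r (Suc j)" for j using seq_suble[OF r(1)] .
  then have s: "Suc (s j) = r (Suc j)" for j
    unfolding s_def by (metis Suc_diff_1 Suc_le_lessD zero_less_Suc less_le_trans)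
  have "strict_mono (\<lambda>j. Suc (s j))"
    unfolding s using r(1) by (simp add: strict_mono_def)
  then have ssub: "strict_mono s" by (simp add: strict_mono_def)
  have "(\<lambda>j. (L (Suc (s j)), S (Suc (s j)), Z (Suc (s j)), \<Lambda> (Suc (s j)))) \<longlonglongrightarrow> (L', S', Z', \<Lambda>')"
    using LIMSEQ_Suc[OF r(2)] by (simp add: s)
  from tendsto_fst[OF this] tendsto_fst[OF tendsto_snd[OF this]]
    tendsto_fst[OF tendsto_snd[OF tendsto_snd[OF this]]]
    tendsto_snd[OF tendsto_snd[OF tendsto_snd[OF this]]]
  have lim1: "(\<lambda>j. L (Suc (s j))) \<longlonglongrightarrow> L'" "(\<lambda>j. S (Suc (s j))) \<longlonglongrightarrow> S'"
    "(\<lambda>j. Z (Suc (s j))) \<longlonglongrightarrow> Z'" "(\<lambda>j. \<Lambda> (Suc (s j))) \<longlonglongrightarrow> \<Lambda>'"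
    by simp_all
  \<comment> \<open>The optimality conditions mix two consecutive iterates; both have the same limit
    because the increments vanish.\<close>
  have shift: "(\<lambda>j. f (Suc (Suc (s j)))) \<longlonglongrightarrow> l"
    if "(\<lambda>j. f (Suc (s j))) \<longlonglongrightarrow> l" "(\<lambda>k. f (Suc k) - f k) \<longlonglongrightarrow> 0" for f :: "nat \<Rightarrow> 'a" and l
  proof -
    have "(\<lambda>j. f (Suc (Suc (s j))) - f (Suc (s j))) \<longlonglongrightarrow> 0"
      using LIMSEQ_subseq_LIMSEQ[OF LIMSEQ_Suc[OF that(2)] ssub] by (simp add: o_def)
    from tendsto_add[OF this that(1)] show ?thesis by simp
  qed
  note lim2 = shift[OF lim1(1) successive_differences(1)] shift[OF lim1(2) successive_differences(2)]
  have Tlim: "(\<lambda>k. T (us k)) \<longlonglongrightarrow> T u" if "us \<longlonglongrightarrow> u" "linear T" for us u and T :: "'a \<Rightarrow> 'a"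
    using that linear_conv_bounded_linear bounded_linear.tendsto by blast
  note op_lims = Tlim[OF _ lin(1)] Tlim[OF _ lin(2)] Tlim[OF _ lin(3)]
    Tlim[OF _ adjoint_linear[OF lin(1)]]
  have res0: "(\<lambda>j. res (Suc (s j))) \<longlonglongrightarrow> 0"
    using LIMSEQ_subseq_LIMSEQ[OF differences_tendsto_0(3) ssub] by (simp add: o_def)
  moreover have "(\<lambda>j. res (Suc (s j))) \<longlonglongrightarrow> B L' + C S' - Z'"
    by (intro tendsto_intros op_lims lim1)
  ultimately have "B L' + C S' - Z' = 0" by (rule LIMSEQ_unique[rotated])
  then have Z': "Z' = B L' + C S'" by simp
  have "(\<lambda>j. (\<beta> - \<tau> * \<beta>) *\<^sub>R res (Suc (s j))) \<longlonglongrightarrow> (\<beta> - \<tau> * \<beta>) *\<^sub>R 0"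
    by (intro tendsto_intros res0)
  moreover have "(\<beta> - \<tau> * \<beta>) *\<^sub>R res (Suc k) = \<Lambda> (Suc k) + grad (Suc k)" for k
    by (simp only: multiplier_eq diff_add_cancel)
  moreover have "(\<lambda>j. \<Lambda> (Suc (s j)) + grad (Suc (s j))) \<longlonglongrightarrow> \<Lambda>' + adjoint A (A Z' - D)"
    by (intro tendsto_intros op_lims lim1)
  ultimately have "\<Lambda>' + adjoint A (A Z' - D) = 0"
    by (simp add: LIMSEQ_unique)
  then have \<Lambda>': "adjoint A (A (B L' + C S') - D) = - \<Lambda>'"
    unfolding Z' by (simp add: add_eq_0_iff)
  \<comment> \<open>By \<open>Z'\<close> the penalty term is zero, so the subgradient is
    \<open>adjoint B \<Lambda>'\<close>; the limit identity for \<open>\<Lambda>'\<close> turns this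
    into the stationarity condition.\<close>
  have "adjoint B (\<Lambda>' - \<beta> *\<^sub>R (B L' + (C S' - Z'))) \<in> limiting_subdiff \<Psi> L'"
    using Psi(1,2) lin(2) beta(1)[THEN less_imp_le] _ L_minimizer lim2(1) lim1(4)
    by (rule limiting_subdiff_of_quadratic_minimizers)
      (auto simp: Psi_L intro!: tendsto_diff op_lims lim1)
  moreover have "adjoint C (\<Lambda>' - \<beta> *\<^sub>R (C S' + (B L' - Z'))) \<in> limiting_subdiff \<Phi> S'"
    using Phi(1,2) lin(3) beta(1)[THEN less_imp_le] _ S_minimizer lim2(2) lim1(4)
    by (rule limiting_subdiff_of_quadratic_minimizers)
      (auto simp: Phi_S intro!: tendsto_diff op_lims lim1 lim2)
  moreover have "adjoint T (- v) = - adjoint T v" if "linear T" for T :: "'a \<Rightarrow> 'a" and v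
    using adjoint_linear[OF that] by (rule linear_neg)
  ultimately show ?thesis
    unfolding stationary_point_def \<Lambda>' Z' using lin
    by (force simp: image_iff)
qed

end

theorem theorem4p3:
  fixes \<Psi> \<Phi> :: "real ^ 'n ^ 'm \<Rightarrow> ereal"
    and A B C :: "real ^ 'n ^ 'm \<Rightarrow> real ^ 'n ^ 'm"
    and D :: "real ^ 'n ^ 'm"
    and \<tau> \<beta> :: real
    and L S Z \<Lambda> :: "nat \<Rightarrow> real ^ 'n ^ 'm"
  assumes Psi: "proper_fun \<Psi>" "lsc_fun \<Psi>" "\<And>X. 0 \<le> \<Psi> X" "convex_fun \<Psi>"
    and Phi: "proper_fun \<Phi>" "lsc_fun \<Phi>" "\<And>X. 0 \<le> \<Phi> X"
    and lin: "linear A" "linear B" "linear C"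
    and inj: "inj B" "inj C"
    and tau: "0 < \<tau>" "\<tau> < (1 + sqrt 5) / 2"
    and beta: "0 < \<beta>" "beta_bar A \<tau> < \<beta>"
    and admm: "admm_sequence \<Psi> \<Phi> A B C D \<tau> \<beta> L S Z \<Lambda>"
    and a1: "\<exists>\<sigma>>0. loewner_ge (adjoint B \<circ> B) (\<lambda>X. \<sigma> *\<^sub>R X)"
            "\<exists>\<sigma>'>0. loewner_ge (adjoint C \<circ> C) (\<lambda>X. \<sigma>' *\<^sub>R X)"
    and a2: "continuous_on (eff_dom \<Psi>) \<Psi>"
    and a3: "potential \<Psi> \<Phi> A B C D \<tau> \<beta> (L 1) (S 1) (Z 1) (\<Lambda> 1) < liminf_at_infinity \<Psi> \<Phi>"
  shows "(\<lambda>k. norm (L (Suc k) - L k) + norm (S (Suc k) - S k)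
            + norm (Z (Suc k) - Z k) + norm (\<Lambda> (Suc k) - \<Lambda> k)) \<longlonglongrightarrow> 0 \<and>
         (\<forall>L' S' Z' \<Lambda>'. cluster_point (\<lambda>k. (L k, S k, Z k, \<Lambda> k)) (L', S', Z', \<Lambda>') \<longrightarrow>
            stationary_point \<Psi> \<Phi> A B C D L' S')"
proof -
  \<comment> \<open>A value strictly below an extended real is below \<infinity>, which supplies
    \<open>start\<close>.\<close>
  have "potential \<Psi> \<Phi> A B C D \<tau> \<beta> (L 1) (S 1) (Z 1) (\<Lambda> 1) < \<infinity>"
    using a3 by (rule less_le_trans) simp
  then interpret admm_iterates \<Psi> \<Phi> A B C D \<tau> \<beta> L S Z \<Lambda>
    by (rule admm_iterates.intro[OF Psi(2-4) Phi(2,3) lin inj tau beta admm])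
  have "(\<lambda>k. norm (L (Suc k) - L k) + norm (S (Suc k) - S k)
      + norm (Z (Suc k) - Z k) + norm (\<Lambda> (Suc k) - \<Lambda> k)) \<longlonglongrightarrow> 0 + 0 + 0 + 0"
    by (intro tendsto_add tendsto_norm_zero successive_differences)
  then show ?thesis using cluster_point_stationary by simp
qed

end
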